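(* Let $A, B \in \mathbb{R}^{n\times n}$ be such that $A+B$ is nonsingular. Then the generalized absolute value equation $Ax + B|x| = b$ has a unique solution $x \in \mathbb{R}^n$ for every $b \in \mathbb{R}^{n}$ if and only if the matrix $(A+B)^{-1}(A-B)$ is a $P$-matrix.
   Context: For $x \in \mathbb{R}^n$, $|x|$ denotes the componentwise absolute value of $x$. A matrix $M\in \mathbb{R}^{n\times n}$ is called a $P$-matrix if all its principal minors are positive. *)

theory Defs
  imports "HOL-Analysis.Analysis"
begin

text \<open>
  The determinant of the principal submatrix of \<open>M\<close> with rows and columns in \<open>S\<close>. Since the
  dimension of a matrix is a type and \<open>S\<close> is a set, this is the defining Leibniz sum of
  \<^const>\<open>det\<close> taken over \<open>S\<close>; lemma \<open>principal_minor_range\<close> identifies it with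
  \<^const>\<open>det\<close> of the submatrix.
\<close>

definition principal_minor :: "'a::comm_ring_1 ^ 'n ^ 'n \<Rightarrow> 'n set \<Rightarrow> 'a" where
  "principal_minor M S =
     (\<Sum>p | p permutes S. of_int (sign p) * (\<Prod>i\<in>S. M $ i $ p i))"

definition P_matrix :: "real ^ 'n ^ 'n \<Rightarrow> bool" where
  "P_matrix M \<longleftrightarrow> (\<forall>S. S \<noteq> {} \<longrightarrow> principal_minor M S > 0)"

lemma principal_minor_UNIV: "principal_minor M UNIV = det M"
  by (simp add: principal_minor_def det_def)

lemma principal_minor_range:
  fixes M :: "'a::comm_ring_1 ^ 'n ^ 'n" and f :: "'k::finite \<Rightarrow> 'n"
  assumes "inj f"
  shows "principal_minor M (range f) = det (\<chi> i j. M $ f i $ f j)"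
proof -
  have bij: "bij_betw f UNIV (range f)"
    using assms by (simp add: bij_betw_def)
  have "det (\<chi> i j. M $ f i $ f j) =
      (\<Sum>p | p permutes (UNIV :: 'k set). of_int (sign p) * (\<Prod>i\<in>UNIV. M $ f i $ f (p i)))"
    by (simp add: det_def)
  also have "\<dots> = principal_minor M (range f)"
    unfolding principal_minor_def
  proof (rule sum.reindex_bij_witness
      [of _ "map_permutation (range f) (inv_into UNIV f)" "map_permutation UNIV f"], goal_cases)
    case (1 p)
    then show ?case
      using assms by (subst map_permutation_compose_inv[OF bij]) auto
  next
    case (2 p)
    then show ?case
      using assms map_permutation_permutes[OF bij] by auto
  next
    case (3 p)
    have "bij_betw (inv_into UNIV f) (range f) UNIV"
      using bij by (rule bij_betw_inv_into)
    then show ?case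
      using 3 by (subst map_permutation_compose_inv) (auto simp: assms f_inv_into_f)
  next
    case (4 p)
    have "bij_betw (inv_into UNIV f) (range f) UNIV"
      using bij by (rule bij_betw_inv_into)
    then show ?case
      using 4 map_permutation_permutes by blast
  next
    case (5 p)
    then show ?case
      using assms
      by (simp add: sign_map_permutation prod.reindex map_permutation_apply)
  qed
  finally show ?thesis ..
qed

end

theory Submission
  imports Defs
begin

text \<open>
  Componentwise \<open>\<bar>x\<bar> - \<bar>y\<bar> = s (x - y)\<close> for some \<open>s \<in> [-1, 1]\<close>, and conversely every pair \<open>(z, s z)\<close>
  with \<open>s \<in> [-1, 1]\<close> is of the form \<open>(x - y, \<bar>x\<bar> - \<bar>y\<bar>)\<close>. Hence \<open>F x = A x + B \<bar>x\<bar>\<close> is injective iff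
  \<open>A + B diag(s)\<close> is nonsingular for all \<open>s \<in> [-1, 1]\<^sup>n\<close>. Injectivity already implies surjectivity: by
  invariance of domain the range of \<open>F\<close> is open, and it is a cone.

  With \<open>s = 1 - 2 e\<close> one has \<open>A + B diag(s) = (A + B) (diag(1 - e) + M diag(e))\<close>, where
  \<open>M = (A + B)\<^sup>-\<^sup>1 (A - B)\<close>. The determinant of the second factor is a sum of principal minors of \<open>M\<close>
  with weights \<open>\<Prod>\<^bsub>i\<in>T\<^esub> e\<^sub>i \<Prod>\<^bsub>i\<notin>T\<^esub> (1 - e\<^sub>i)\<close>, so it is positive on the cube \<open>[0, 1]\<^sup>n\<close> if \<open>M\<close> is a
  P-matrix. If conversely it has no zero on the cube, it is positive there by the intermediate value
  theorem, since it is \<open>1\<close> at \<open>e = 0\<close>; its values at the vertices are the principal minors.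
\<close>

text \<open>The product of \<open>M\<close> with the diagonal matrix of \<open>s\<close>;
  \<open>scale_columns (mat 1) s\<close> is that diagonal matrix itself.\<close>

definition scale_columns :: "'a::times ^ 'n ^ 'm \<Rightarrow> 'a ^ 'n \<Rightarrow> 'a ^ 'n ^ 'm" where
  "scale_columns M s = (\<chi> i j. M $ i $ j * s $ j)"

lemma scale_columns_vector_mult: "scale_columns M s *v z = M *v (s * z)"
  for M :: "'a::comm_semiring_1 ^ 'n ^ 'm"
  by (simp add: scale_columns_def matrix_vector_mult_def vec_eq_iff mult.assoc)

lemma matrix_mult_scale_columns: "A ** scale_columns M s = scale_columns (A ** M) s"
  for M :: "'a::comm_semiring_1 ^ 'n ^ 'm"
  by (simp add: scale_columns_def matrix_matrix_mult_def vec_eq_iff sum_distrib_right mult.assoc)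

section \<open>Determinants on the cube and principal minors\<close>

lemma continuous_on_det:
  fixes M :: "'b::topological_space \<Rightarrow> 'a::{comm_ring_1, real_normed_algebra_1} ^ 'n ^ 'n"
  assumes "continuous_on S M"
  shows "continuous_on S (\<lambda>t. det (M t))"
  unfolding det_def using assms by (intro continuous_intros)

lemma principal_minor_empty [simp]: "principal_minor M {} = 1"
  by (simp add: principal_minor_def)

text \<open>Expanding each Leibniz product, \<open>T\<close> collects the rows that contribute their
  entry of \<open>M\<close>. The other rows contribute entries of \<open>mat 1\<close>, so only
  permutations fixing \<open>-T\<close> pointwise survive, and these sum to the minor of
  \<open>T\<close>.\<close>

lemma det_scale_columns_add:
  fixes M :: "'a::comm_ring_1 ^ 'n ^ 'n"
  shows "det (scale_columns (mat 1) d + scale_columns M e) =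
    (\<Sum>T\<in>UNIV. (\<Prod>i\<in>T. e $ i) * (\<Prod>i\<in>-T. d $ i) * principal_minor M T)"
proof -
  let ?P = "{p. p permutes (UNIV :: 'n set)}"
  let ?f = "\<lambda>p T. (\<Prod>i\<in>T. M $ i $ p i * e $ p i) * (\<Prod>i\<in>-T. mat 1 $ i $ p i * d $ p i)"
  have "det (scale_columns (mat 1) d + scale_columns M e) =
      (\<Sum>p\<in>?P. of_int (sign p) * (\<Prod>i\<in>UNIV. M $ i $ p i * e $ p i + mat 1 $ i $ p i * d $ p i))"
    by (simp add: det_def scale_columns_def add.commute)
  also have "\<dots> = (\<Sum>p\<in>?P. \<Sum>T\<in>UNIV. of_int (sign p) * ?f p T)"
    by (simp add: prod_add sum_distrib_left Compl_eq_Diff_UNIV)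
  also have "\<dots> = (\<Sum>T\<in>UNIV. \<Sum>p\<in>?P. of_int (sign p) * ?f p T)"
    by (rule sum.swap)
  also have "\<dots> = (\<Sum>T\<in>UNIV. (\<Prod>i\<in>T. e $ i) * (\<Prod>i\<in>-T. d $ i) * principal_minor M T)"
  proof (rule sum.cong)
    fix T :: "'n set"
    have "(\<Sum>p\<in>?P. of_int (sign p) * ?f p T) =
        (\<Sum>p | p permutes T. of_int (sign p) * ?f p T)"
    proof (rule sum.mono_neutral_right)
      show "\<forall>p\<in>?P - {p. p permutes T}. of_int (sign p) * ?f p T = 0"
      proof
        fix p assume p: "p \<in> ?P - {p. p permutes T}"
        then obtain i where "i \<in> -T" "p i \<noteq> i"
          using permutes_superset[of p UNIV T] by auto
        then have "(\<Prod>i\<in>-T. mat 1 $ i $ p i * d $ p i) = 0"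
          by (intro prod_zero bexI[of _ i]) (auto simp: mat_def)
        then show "of_int (sign p) * ?f p T = 0"
          by simp
      qed
    qed (auto intro: permutes_subset)
    also have "\<dots> = (\<Sum>p | p permutes T.
        (\<Prod>i\<in>T. e $ i) * (\<Prod>i\<in>-T. d $ i) * (of_int (sign p) * (\<Prod>i\<in>T. M $ i $ p i)))"
    proof (rule sum.cong)
      fix p assume "p \<in> {p. p permutes T}"
      then have p: "p permutes T" by simp
      have "(\<Prod>i\<in>T. e $ p i) = (\<Prod>i\<in>T. e $ i)"
        using prod.permute[OF p, of "\<lambda>i. e $ i"] by (simp add: o_def)
      moreover have "(\<Prod>i\<in>-T. mat 1 $ i $ p i * d $ p i) = (\<Prod>i\<in>-T. d $ i)"
        using p by (intro prod.cong) (auto simp: mat_def permutes_not_in)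
      ultimately show "of_int (sign p) * ?f p T =
          (\<Prod>i\<in>T. e $ i) * (\<Prod>i\<in>-T. d $ i) * (of_int (sign p) * (\<Prod>i\<in>T. M $ i $ p i))"
        by (simp add: prod.distrib algebra_simps)
    qed simp
    finally show "(\<Sum>p\<in>?P. of_int (sign p) * ?f p T) =
        (\<Prod>i\<in>T. e $ i) * (\<Prod>i\<in>-T. d $ i) * principal_minor M T"
      by (simp add: principal_minor_def sum_distrib_left)
  qed simp
  finally show ?thesis .
qed

lemma P_matrix_iff_det_nonzero:
  fixes M :: "real ^ 'n ^ 'n"
  shows "P_matrix M \<longleftrightarrow>
    (\<forall>e. (\<forall>i. e $ i \<in> {0..1}) \<longrightarrow> det (scale_columns (mat 1) (1 - e) + scale_columns M e) \<noteq> 0)"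
    (is "_ \<longleftrightarrow> (\<forall>e. ?cube e \<longrightarrow> ?D e \<noteq> 0)")
proof safe
  fix e :: "real ^ 'n"
  assume P: "P_matrix M" and e: "\<forall>i. e $ i \<in> {0..1}" and 0: "?D e = 0"
  have minor: "principal_minor M T > 0" for T
    using P by (cases "T = {}") (auto simp: P_matrix_def)
  let ?w = "\<lambda>T. (\<Prod>i\<in>T. e $ i) * (\<Prod>i\<in>-T. (1 - e) $ i) * principal_minor M T"
  have nonneg: "?w T \<ge> 0" for T
    using e minor[of T] by (auto intro!: mult_nonneg_nonneg prod_nonneg simp: less_imp_le)
  \<comment> \<open>The support of \<open>e\<close> gives a strictly positive summand:
    \<open>e $ i > 0\<close> on \<open>T\<close> and \<open>1 - e $ i = 1\<close> off
    \<open>T\<close>.\<close>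
  define T where "T = {i. e $ i > 0}"
  have "?w T > 0"
    using e minor[of T]
    by (intro mult_pos_pos prod_pos) (auto simp: T_def not_less less_eq_real_def)
  then have "(\<Sum>T\<in>UNIV. ?w T) > 0"
    using nonneg by (intro sum_pos2[of _ T]) auto
  with 0 show False
    by (simp add: det_scale_columns_add)
next
  assume D: "\<forall>e. ?cube e \<longrightarrow> ?D e \<noteq> 0"
  show "P_matrix M"
    unfolding P_matrix_def
  proof (intro allI impI)
    fix T :: "'n set"
    define v :: "real ^ 'n" where "v = (\<chi> i. if i \<in> T then 1 else 0)"
    have "continuous_on {0..1} (\<lambda>t. ?D (t *\<^sub>R v))"
      unfolding scale_columns_def by (intro continuous_intros continuous_on_det)
    moreover have "?D (t *\<^sub>R v) \<noteq> 0" if "t \<in> {0..1}" for t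
      using D that by (simp add: v_def)
    moreover have "?D (0 *\<^sub>R v) = 1"
    proof -
      have "scale_columns (mat 1) (1 - 0) + scale_columns M 0 = mat 1"
        by (simp add: scale_columns_def vec_eq_iff)
      then show ?thesis by simp
    qed
    \<comment> \<open>A value \<le> 0 at \<open>t = 1\<close> would force a zero on the segment from
      \<open>0\<close> to the vertex \<open>v\<close>.\<close>
    ultimately have "?D (1 *\<^sub>R v) > 0"
      using IVT2'[of "\<lambda>t. ?D (t *\<^sub>R v)" 1 0 0] by (force simp: not_less)
    moreover have "?D v = principal_minor M T"
    proof -
      \<comment> \<open>If \<open>X\<close> differs from \<open>T\<close>, an index in just one of
        them gives a factor \<open>v $ i = 0\<close> or \<open>(1 - v) $ i = 0\<close>.\<close>
      have "?D v = (\<Sum>X\<in>{T}. (\<Prod>i\<in>X. v $ i) * (\<Prod>i\<in>-X. (1 - v) $ i) * principal_minor M X)"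
        unfolding det_scale_columns_add
      proof (rule sum.mono_neutral_right)
        show "\<forall>X\<in>UNIV - {T}. (\<Prod>i\<in>X. v $ i) * (\<Prod>i\<in>-X. (1 - v) $ i) * principal_minor M X = 0"
          by (auto simp: v_def)
      qed auto
      also have "\<dots> = principal_minor M T"
        by (simp add: v_def)
      finally show ?thesis .
    qed
    ultimately show "principal_minor M T > 0" by simp
  qed
qed

section \<open>Slopes of the componentwise absolute value\<close>

lemma abs_vec_nth: "\<bar>x :: real ^ 'n\<bar> $ i = \<bar>x $ i\<bar>"
  by (simp add: abs_vec_def)

lemma abs_diff_eq_slope:
  fixes x y :: "real ^ 'n"
  obtains s where "\<And>i. s $ i \<in> {-1..1}" "\<bar>x\<bar> - \<bar>y\<bar> = s * (x - y)"
proof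
  \<comment> \<open>Where \<open>x $ i = y $ i\<close>, division by zero yields slope 0, which is
    admissible.\<close>
  let ?s = "\<chi> i. (\<bar>x $ i\<bar> - \<bar>y $ i\<bar>) / (x $ i - y $ i)"
  show "?s $ i \<in> {-1..1}" for i
    by (cases "x $ i = y $ i") (auto simp: field_simps abs_le_iff divide_le_eq le_divide_eq)
  show "\<bar>x\<bar> - \<bar>y\<bar> = ?s * (x - y)"
    by (simp add: vec_eq_iff abs_vec_nth)
qed

text \<open>Turns a kernel vector \<open>z\<close> of \<open>A + scale_columns B s\<close> into two
  distinct points with the same image.\<close>

lemma slope_eq_abs_diff:
  fixes s z :: "real ^ 'n"
  assumes "\<And>i. s $ i \<in> {-1..1}"
  obtains x y where "x - y = z" "\<bar>x\<bar> - \<bar>y\<bar> = s * z"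
proof
  \<comment> \<open>Choosing \<open>x\<close> with the sign of \<open>z\<close> and \<open>y\<close>
    with the opposite sign makes \<bar>x\<bar> - \<bar>y\<bar> equal to \<open>x + y\<close> up to
    the sign of \<open>z\<close>. Hence \<open>x + y\<close> must be
    \<open>s * \<bar>z\<bar>\<close>, while \<open>x - y = z\<close>.\<close>
  let ?x = "\<chi> i. (z $ i + s $ i * \<bar>z $ i\<bar>) / 2"
  show "?x - (?x - z) = z"
    by simp
  have abs_eq: "\<bar>a + c * \<bar>a\<bar>\<bar> - \<bar>c * \<bar>a\<bar> - a\<bar> = 2 * (c * a)" if "c \<in> {-1..1}" for a c :: real
  proof -
    have "\<bar>a + c * \<bar>a\<bar>\<bar> = \<bar>a\<bar> + c * a" "\<bar>c * \<bar>a\<bar> - a\<bar> = \<bar>a\<bar> - c * a"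
      using that mult_right_mono[of c 1 "\<bar>a\<bar>"] mult_right_mono[of "-1" c "\<bar>a\<bar>"]
      by (auto simp: abs_if algebra_simps split: if_splits)
    then show ?thesis by simp
  qed
  have "\<bar>?x $ i\<bar> - \<bar>?x $ i - z $ i\<bar> = s $ i * z $ i" for i
  proof -
    have "?x $ i - z $ i = (s $ i * \<bar>z $ i\<bar> - z $ i) / 2"
      by (simp add: field_simps)
    then show ?thesis
      using abs_eq[OF assms, of "z $ i" i] by simp
  qed
  then show "\<bar>?x\<bar> - \<bar>?x - z\<bar> = s * z"
    by (simp add: vec_eq_iff abs_vec_nth)
qed

lemma inj_abs_value_map_iff:
  fixes A B :: "real ^ 'n ^ 'n"
  shows "inj (\<lambda>x. A *v x + B *v \<bar>x\<bar>) \<longleftrightarrow>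
    (\<forall>s. (\<forall>i. s $ i \<in> {-1..1}) \<longrightarrow> det (A + scale_columns B s) \<noteq> 0)"
    (is "inj ?F \<longleftrightarrow> _")
proof -
  have ker: "det C \<noteq> 0 \<longleftrightarrow> (\<forall>z. C *v z = 0 \<longrightarrow> z = 0)" for C :: "real ^ 'n ^ 'n"
    using det_nz_iff_inj[of "(*v) C"] linear_injective_0[of "(*v) C"] by simp
  have diff: "?F x - ?F y = (A + scale_columns B s) *v (x - y)"
    if "\<bar>x\<bar> - \<bar>y\<bar> = s * (x - y)" for s x y
  proof -
    have "scale_columns B s *v (x - y) = B *v \<bar>x\<bar> - B *v \<bar>y\<bar>"
      by (simp only: scale_columns_vector_mult flip: that matrix_vector_mult_diff_distrib)
    then show ?thesis
      by (simp add: matrix_vector_mult_add_rdistrib matrix_vector_mult_diff_distrib)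
  qed
  show ?thesis
  proof safe
    fix s :: "real ^ 'n"
    assume inj: "inj ?F" and s: "\<forall>i. s $ i \<in> {-1..1}" and 0: "det (A + scale_columns B s) = 0"
    then obtain z where z: "(A + scale_columns B s) *v z = 0" "z \<noteq> 0"
      using ker by blast
    obtain x y where xy: "x - y = z" "\<bar>x\<bar> - \<bar>y\<bar> = s * z"
      using slope_eq_abs_diff[of s z] s by blast
    then have "?F x - ?F y = 0"
      using diff[of x y s] z by simp
    then have "x = y"
      using injD[OF inj, of x y] by (simp only: right_minus_eq)
    with xy z show False by simp
  next
    assume D: "\<forall>s. (\<forall>i. s $ i \<in> {-1..1}) \<longrightarrow> det (A + scale_columns B s) \<noteq> 0"
    show "inj ?F"
    proof (rule injI)
      fix x y assume eq: "?F x = ?F y"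
      obtain s where s: "\<And>i. s $ i \<in> {-1..1}" "\<bar>x\<bar> - \<bar>y\<bar> = s * (x - y)"
        using abs_diff_eq_slope by blast
      then have "(A + scale_columns B s) *v (x - y) = 0"
        using diff[of x y s] eq by simp
      then have "x - y = 0"
        using D s(1) ker by blast
      then show "x = y" by simp
    qed
  qed
qed

section \<open>From injectivity to bijectivity\<close>

lemma surj_if_inj_homogeneous:
  fixes f :: "'a::euclidean_space \<Rightarrow> 'a"
  assumes cont: "continuous_on UNIV f" and inj: "inj f"
    and hom: "\<And>c x. c > 0 \<Longrightarrow> f (c *\<^sub>R x) = c *\<^sub>R f x"
  shows "surj f"
proof -
  \<comment> \<open>Homogeneity is assumed for positive factors only, so \<open>f 0 = 0\<close> is
    derived from \<open>c = 2\<close>.\<close>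
  have "f 0 = 2 *\<^sub>R f 0"
    using hom[of 2 0] by simp
  then have "f 0 = 0"
    by (simp add: scaleR_2)
  then have "0 \<in> range f"
    by (metis rangeI)
  moreover have "open (range f)"
    using invariance_of_domain[OF cont open_UNIV] inj by simp
  ultimately obtain r where r: "r > 0" "cball 0 r \<subseteq> range f"
    by (meson open_contains_cball)
  have "y \<in> range f" for y
  proof (cases "y = 0")
    case False
    define c where "c = norm y / r"
    have c: "c > 0"
      using False r by (simp add: c_def)
    have "(1 / c) *\<^sub>R y \<in> cball 0 r"
      using False r by (simp add: c_def)
    then obtain x where "(1 / c) *\<^sub>R y = f x"
      using r by blast
    then have "y = f (c *\<^sub>R x)"
      using c hom[of c x] by (simp flip: \<open>(1 / c) *\<^sub>R y = f x\<close>)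
    then show ?thesis by blast
  qed (use \<open>0 \<in> range f\<close> in simp)
  then show ?thesis by auto
qed

lemma bij_abs_value_map_iff_inj:
  fixes A B :: "real ^ 'n ^ 'n"
  shows "bij (\<lambda>x. A *v x + B *v \<bar>x\<bar>) \<longleftrightarrow> inj (\<lambda>x. A *v x + B *v \<bar>x\<bar>)" (is "bij ?F \<longleftrightarrow> _")
proof -
  have "continuous_on UNIV (\<lambda>x :: real ^ 'n. \<bar>x\<bar>)"
    unfolding abs_vec_def by (intro continuous_intros)
  then have "continuous_on UNIV ?F"
    by (intro continuous_on_add bounded_linear.continuous_on[OF matrix_vector_mul_bounded_linear]
        continuous_on_id)
  moreover have "?F (c *\<^sub>R x) = c *\<^sub>R ?F x" if "c > 0" for c x
  proof -
    have "\<bar>c *\<^sub>R x\<bar> = c *\<^sub>R \<bar>x\<bar>"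
      using that by (simp add: vec_eq_iff abs_vec_nth abs_mult)
    then show ?thesis
      by (simp add: matrix_vector_mult_scaleR scaleR_right_distrib)
  qed
  ultimately show ?thesis
    using surj_if_inj_homogeneous[of ?F] by (auto simp: bij_def)
qed

theorem theorem3p1:
  fixes A B :: "real ^ 'n ^ 'n"
  assumes "invertible (A + B)"
  shows "(\<forall>b :: real ^ 'n. \<exists>!x :: real ^ 'n. A *v x + B *v \<bar>x\<bar> = b)
    \<longleftrightarrow> P_matrix (matrix_inv (A + B) ** (A - B))"
proof -
  let ?M = "matrix_inv (A + B) ** (A - B)"
  let ?N = "\<lambda>e. scale_columns (mat 1) (1 - e) + scale_columns ?M e"
  have factor: "A + scale_columns B (1 - 2 *\<^sub>R e) = (A + B) ** ?N e" for e
  proof -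
    have "(A + B) ** matrix_inv (A + B) = mat 1"
      using assms someI_ex[of "\<lambda>C. (A + B) ** C = mat 1 \<and> C ** (A + B) = mat 1"]
      by (simp add: invertible_def matrix_inv_def)
    then have "(A + B) ** ?M = A - B"
      by (simp add: matrix_mul_assoc)
    then show ?thesis
      \<comment> \<open>What remains is the entrywise identity
        \<open>(a + b) * (1 - e) + (a - b) * e = a + b * (1 - 2 * e)\<close>.\<close>
      by (simp add: matrix_add_ldistrib matrix_mult_scale_columns)
        (simp add: scale_columns_def vec_eq_iff algebra_simps)
  qed
  have "det (A + B) \<noteq> 0"
    using assms by (simp add: invertible_det_nz)
  then have det: "det (A + scale_columns B (1 - 2 *\<^sub>R e)) \<noteq> 0 \<longleftrightarrow> det (?N e) \<noteq> 0" for e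
    by (simp add: factor det_mul)
  have "(\<forall>b. \<exists>!x. A *v x + B *v \<bar>x\<bar> = b) \<longleftrightarrow> bij (\<lambda>x. A *v x + B *v \<bar>x\<bar>)"
    by (simp add: bij_iff)
  also have "\<dots> \<longleftrightarrow> (\<forall>s. (\<forall>i. s $ i \<in> {-1..1}) \<longrightarrow> det (A + scale_columns B s) \<noteq> 0)"
    by (simp only: bij_abs_value_map_iff_inj inj_abs_value_map_iff)
  also have "\<dots> \<longleftrightarrow> (\<forall>e. (\<forall>i. e $ i \<in> {0..1}) \<longrightarrow> det (?N e) \<noteq> 0)"
  proof safe
    fix e :: "real ^ 'n"
    assume *: "\<forall>s. (\<forall>i. s $ i \<in> {-1..1}) \<longrightarrow> det (A + scale_columns B s) \<noteq> 0"
      and e: "\<forall>i. e $ i \<in> {0..1}" and 0: "det (?N e) = 0"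
    have "\<forall>i. (1 - 2 *\<^sub>R e) $ i \<in> {-1..1}"
      using e by simp
    with * det 0 show False by blast
  next
    fix s :: "real ^ 'n"
    assume *: "\<forall>e. (\<forall>i. e $ i \<in> {0..1}) \<longrightarrow> det (?N e) \<noteq> 0"
      and s: "\<forall>i. s $ i \<in> {-1..1}" and 0: "det (A + scale_columns B s) = 0"
    define e where "e = (1 / 2) *\<^sub>R (1 - s)"
    have "s = 1 - 2 *\<^sub>R e" "\<forall>i. e $ i \<in> {0..1}"
      using s by (simp_all add: e_def)
    with * det 0 show False by blast
  qed
  also have "\<dots> \<longleftrightarrow> P_matrix ?M"
    by (simp only: P_matrix_iff_det_nonzero)
  finally show ?thesis .
qed

end
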